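(* Let $\mathcal{Z}$ denote the space $c_0$ equipped with the norm $\|x\|_{\mathcal{Z}}=\|x\|_\infty+\left(\sum_{i=1}^\infty \frac{|x(i)|^2}{2^i}\right)^{1/2}$, and let $X=c_0\oplus_\infty\mathcal{Z}$, i.e. $c_0\times\mathcal{Z}$ with norm $\|(y,z)\|=\max\{\|y\|_\infty,\|z\|_{\mathcal{Z}}\}$. Then the norm of $X$ is strongly subdifferentiable, and $X$ fails the $\mathbf{L}_{p,p}$-nu.
   Context: For a Banach space $X$ over $\mathbb{K}\in\{\mathbb{R},\mathbb{C}\}$: $\Pi(X)=\{(x,x^* )\in S_X\times S_{X^*}: x^*(x)=1\}$; for $T\in\mathcal{L}(X)$ (bounded linear operators on $X$), $v(T)=\sup\{|x^*(Tx)|:(x,x^* )\in\Pi(X)\}$. $X$ has the $\mathbf{L}_{p,p}$-nu if for every $\varepsilon>0$ and $(x,x^* )\in\Pi(X)$ there is $\eta(\varepsilon,(x,x^* ))>0$ such that whenever $T\in\mathcal{L}(X)$ with $v(T)=1$ satisfies $|x^*(Tx)|>1-\eta(\varepsilon,(x,x^* ))$, there is $S\in\mathcal{L}(X)$ with $v(S)=1$, $|x^*(Sx)|=1$ and $\|S-T\|<\varepsilon$. The norm of $X$ is strongly subdifferentiable if for every $x\in X$ the limit $\lim_{t\to0^+}\frac{\|x+th\|-\|x\|}{t}$ exists uniformly in $h\in B_X$. *)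

theory Defs
  imports "HOL-Analysis.Analysis"
begin

text \<open>Scalars: a type 'k, instantiated in the theorem with real and complex.
Points of X = c_0 (+)_inf Z are pairs (y,z) of scalar sequences.\<close>

type_synonym 'k pt = "(nat \<Rightarrow> 'k) \<times> (nat \<Rightarrow> 'k)"

definition c0 :: "(nat \<Rightarrow> 'k::real_normed_field) set" where
  "c0 = {x. x \<longlonglongrightarrow> 0}"

definition Xset :: "'k::real_normed_field pt set" where
  "Xset = c0 \<times> c0"

definition addX :: "'k::real_normed_field pt \<Rightarrow> 'k pt \<Rightarrow> 'k pt" where
  "addX p q = ((\<lambda>i. fst p i + fst q i), (\<lambda>i. snd p i + snd q i))"

definition smulX :: "'k::real_normed_field \<Rightarrow> 'k pt \<Rightarrow> 'k pt" where
  "smulX c p = ((\<lambda>i. c * fst p i), (\<lambda>i. c * snd p i))"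

definition supn :: "(nat \<Rightarrow> 'k::real_normed_field) \<Rightarrow> real" where
  "supn x = (SUP i. norm (x i))"

definition Znorm :: "(nat \<Rightarrow> 'k::real_normed_field) \<Rightarrow> real" where
  "Znorm z = supn z + sqrt (\<Sum>i. norm (z i) ^ 2 / 2 ^ (Suc i))"

definition normX :: "'k::real_normed_field pt \<Rightarrow> real" where
  "normX p = max (supn (fst p)) (Znorm (snd p))"

definition ballX :: "'k::real_normed_field pt set" where
  "ballX = {p \<in> Xset. normX p \<le> 1}"

text \<open>Elements of the dual X*: bounded linear functionals on X (values off X irrelevant).\<close>
definition dualX :: "('k::real_normed_field pt \<Rightarrow> 'k) \<Rightarrow> bool" where
  "dualX f \<longleftrightarrow>
     (\<forall>p\<in>Xset. \<forall>q\<in>Xset. f (addX p q) = f p + f q) \<and>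
     (\<forall>c. \<forall>p\<in>Xset. f (smulX c p) = c * f p) \<and>
     (\<exists>C. \<forall>p\<in>Xset. norm (f p) \<le> C * normX p)"

definition dnorm :: "('k::real_normed_field pt \<Rightarrow> 'k) \<Rightarrow> real" where
  "dnorm f = (SUP p\<in>ballX. norm (f p))"

definition opX :: "('k::real_normed_field pt \<Rightarrow> 'k pt) \<Rightarrow> bool" where
  "opX T \<longleftrightarrow> T ` Xset \<subseteq> Xset \<and>
     (\<forall>p\<in>Xset. \<forall>q\<in>Xset. T (addX p q) = addX (T p) (T q)) \<and>
     (\<forall>c. \<forall>p\<in>Xset. T (smulX c p) = smulX c (T p)) \<and>
     (\<exists>C. \<forall>p\<in>Xset. normX (T p) \<le> C * normX p)"

definition opnorm :: "('k::real_normed_field pt \<Rightarrow> 'k pt) \<Rightarrow> real" where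
  "opnorm T = (SUP p\<in>ballX. normX (T p))"

definition opdiff :: "('k::real_normed_field pt \<Rightarrow> 'k pt) \<Rightarrow> ('k pt \<Rightarrow> 'k pt) \<Rightarrow> ('k pt \<Rightarrow> 'k pt)" where
  "opdiff S T = (\<lambda>p. addX (S p) (smulX (-1) (T p)))"

definition PiX :: "('k::real_normed_field pt \<times> ('k pt \<Rightarrow> 'k)) set" where
  "PiX = {(x, f). x \<in> Xset \<and> normX x = 1 \<and> dualX f \<and> dnorm f = 1 \<and> f x = 1}"

definition numrad :: "('k::real_normed_field pt \<Rightarrow> 'k pt) \<Rightarrow> real" where
  "numrad T = (SUP xf\<in>PiX. norm (snd xf (T (fst xf))))"

definition Lpp_nu :: "'k::real_normed_field itself \<Rightarrow> bool" where
  "Lpp_nu (_::'k itself) \<longleftrightarrow>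
    (\<forall>\<epsilon>>0. \<forall>(x, f) \<in> (PiX :: ('k pt \<times> ('k pt \<Rightarrow> 'k)) set). \<exists>\<eta>>0. \<forall>T.
       opX T \<and> numrad T = 1 \<and> norm (f (T x)) > 1 - \<eta> \<longrightarrow>
       (\<exists>S. opX S \<and> numrad S = 1 \<and> norm (f (S x)) = 1 \<and> opnorm (opdiff S T) < \<epsilon>))"

definition strongly_subdiff :: "'k::real_normed_field itself \<Rightarrow> bool" where
  "strongly_subdiff (_::'k itself) \<longleftrightarrow>
    (\<forall>x \<in> (Xset :: 'k pt set). \<exists>D :: 'k pt \<Rightarrow> real. \<forall>\<epsilon>>0. \<exists>\<delta>>0. \<forall>t::real. 0 < t \<and> t < \<delta> \<longrightarrow>
       (\<forall>h \<in> ballX. \<bar>(normX (addX x (smulX (of_real t) h)) - normX x) / t - D h\<bar> < \<epsilon>))"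

end

theory Submission
  imports Defs
begin

text \<open>The norm of X is built by sums and maxima from the supremum norm of c_0 and a weighted
Hilbert norm, and uniform one-sided differentiability survives both operations. Near a nonzero
point of c_0 the supremum is a maximum over finitely many coordinates, and the Hilbert norm is
controlled by Cauchy-Schwarz.

The property fails at \<open>x = (e\<^sub>0, c e\<^sub>0)\<close> and \<open>f = (0, e\<^sub>0\<^sup>*/c)\<close>. The operators
\<open>(y, z) \<mapsto> (0, y\<^sub>0 e\<^sub>0 + y\<^sub>n e\<^sub>n)\<close>, divided by their numerical radius, nearly attain it at
\<open>(x, f)\<close> when n is large. If S has numerical radius 1 attained at \<open>(x, f)\<close>, then moving \<open>(x, f)\<close>
along the curve of states with first component \<open>e\<^sub>0 + t e\<^sub>n\<close> and second component proportional
to \<open>e\<^sub>0 + s e\<^sub>n\<close>, the first-order condition in s at 0 for every t forces the n-th coordinate of the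
second component of \<open>S (e\<^sub>n, 0)\<close> to vanish, so S is at distance at least 1/2 from those operators.\<close>

section \<open>Uniform one-sided derivatives\<close>

text \<open>\<open>\<phi> t h\<close> stands for a norm evaluated at \<open>a + t h\<close> and
  \<open>c\<close> for its value at \<open>a\<close>. \<open>B\<close> is a bare set of directions,
  so the notion can be pulled back along any map of directions. Boundedness of the derivative is
  carried along because comparing two such functions near \<open>t = 0\<close> requires slopes
  bounded uniformly in \<open>h\<close>.\<close>

definition unif_rdiff :: "'b set \<Rightarrow> (real \<Rightarrow> 'b \<Rightarrow> real) \<Rightarrow> real \<Rightarrow> bool" where
  "unif_rdiff B \<phi> c \<longleftrightarrow>
    (\<exists>D. bounded (D ` B) \<and> uniform_limit B (\<lambda>t h. (\<phi> t h - c) / t) D (at_right 0))"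

lemma unif_rdiff_compose:
  assumes "unif_rdiff B \<phi> c" and "g ` A \<subseteq> B"
  shows "unif_rdiff A (\<lambda>t h. \<phi> t (g h)) c"
proof -
  obtain D where D: "bounded (D ` B)" "uniform_limit B (\<lambda>t h. (\<phi> t h - c) / t) D (at_right 0)"
    using assms(1) by (auto simp: unif_rdiff_def)
  have "bounded ((\<lambda>h. D (g h)) ` A)"
    by (rule bounded_subset[OF D(1)]) (use assms(2) in auto)
  moreover have "uniform_limit A (\<lambda>t h. (\<phi> t (g h) - c) / t) (\<lambda>h. D (g h)) (at_right 0)"
  proof (rule uniform_limitI)
    fix e :: real assume "e > 0"
    from uniform_limitD[OF D(2) this]
    show "\<forall>\<^sub>F t in at_right 0. \<forall>h\<in>A. dist ((\<phi> t (g h) - c) / t) (D (g h)) < e"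
      by eventually_elim (use assms(2) in auto)
  qed
  ultimately show ?thesis by (auto simp: unif_rdiff_def)
qed

lemma unif_rdiff_cong:
  assumes "unif_rdiff B \<phi> c"
    and "\<forall>\<^sub>F t in at_right 0. \<forall>h\<in>B. \<psi> t h = \<phi> t h"
  shows "unif_rdiff B \<psi> c"
proof -
  obtain D where D: "bounded (D ` B)" "uniform_limit B (\<lambda>t h. (\<phi> t h - c) / t) D (at_right 0)"
    using assms(1) by (auto simp: unif_rdiff_def)
  have "uniform_limit B (\<lambda>t h. (\<psi> t h - c) / t) D (at_right 0)"
  proof (rule uniform_limitI)
    fix e :: real assume "e > 0"
    from uniform_limitD[OF D(2) this] assms(2)
    show "\<forall>\<^sub>F t in at_right 0. \<forall>h\<in>B. dist ((\<psi> t h - c) / t) (D h) < e"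
      by eventually_elim auto
  qed
  with D(1) show ?thesis by (auto simp: unif_rdiff_def)
qed

lemma unif_rdiff_add:
  assumes "unif_rdiff B \<phi> c" and "unif_rdiff B \<psi> d"
  shows "unif_rdiff B (\<lambda>t h. \<phi> t h + \<psi> t h) (c + d)"
proof -
  obtain D where D: "bounded (D ` B)" "uniform_limit B (\<lambda>t h. (\<phi> t h - c) / t) D (at_right 0)"
    using assms(1) by (auto simp: unif_rdiff_def)
  obtain E where E: "bounded (E ` B)" "uniform_limit B (\<lambda>t h. (\<psi> t h - d) / t) E (at_right 0)"
    using assms(2) by (auto simp: unif_rdiff_def)
  have "uniform_limit B (\<lambda>t h. (\<phi> t h + \<psi> t h - (c + d)) / t) (\<lambda>h. D h + E h) (at_right 0)"
    using uniform_limit_add[OF D(2) E(2)] by (simp add: diff_divide_distrib add_divide_distrib algebra_simps)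
  moreover have "bounded ((\<lambda>h. D h + E h) ` B)"
    by (rule bounded_plus_comp[OF D(1) E(1)])
  ultimately show ?thesis by (auto simp: unif_rdiff_def)
qed

text \<open>For small \<open>t\<close>, \<open>\<phi>\<close> rises above \<open>c\<close> and
  \<open>\<psi>\<close> falls below \<open>d\<close> at most linearly in \<open>t\<close>, uniformly
  in \<open>h\<close>, so the gap between \<open>c\<close> and \<open>d\<close> is not yet used
  up.\<close>

lemma unif_rdiff_eventually_le:
  assumes "unif_rdiff B \<phi> c" and "unif_rdiff B \<psi> d" and "c < d"
  shows "\<forall>\<^sub>F t in at_right 0. \<forall>h\<in>B. \<phi> t h \<le> \<psi> t h"
proof -
  obtain D where D: "bounded (D ` B)" "uniform_limit B (\<lambda>t h. (\<phi> t h - c) / t) D (at_right 0)"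
    using assms(1) by (auto simp: unif_rdiff_def)
  obtain E where E: "bounded (E ` B)" "uniform_limit B (\<lambda>t h. (\<psi> t h - d) / t) E (at_right 0)"
    using assms(2) by (auto simp: unif_rdiff_def)
  obtain M where M: "M > 0" "\<And>h. h \<in> B \<Longrightarrow> \<bar>D h\<bar> \<le> M"
    using D(1) by (auto simp: bounded_pos)
  obtain N where N: "N > 0" "\<And>h. h \<in> B \<Longrightarrow> \<bar>E h\<bar> \<le> N"
    using E(1) by (auto simp: bounded_pos)
  \<comment> \<open>Once the quotients are within 1 of their limits, \<open>\<phi>\<close> rises
    with slope at most \<open>M + 1\<close> and \<open>\<psi>\<close> falls with slope at most
    \<open>N + 1\<close>; before this time they cannot cross.\<close>
  have "(d - c) / (M + N + 2) > 0" using assms(3) M N by simp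
  then have "\<forall>\<^sub>F t in at_right 0. t < (d - c) / (M + N + 2)"
    by (auto simp: eventually_at_right_field)
  moreover have "\<forall>\<^sub>F t::real in at_right 0. 0 < t" by (rule eventually_at_right_less)
  ultimately show ?thesis using uniform_limitD[OF D(2), of 1, simplified] uniform_limitD[OF E(2), of 1, simplified]
  proof eventually_elim
    case (elim t)
    show ?case
    proof
      fix h assume h: "h \<in> B"
      have "\<bar>(\<phi> t h - c) / t - D h\<bar> < 1" "\<bar>(\<psi> t h - d) / t - E h\<bar> < 1"
        using elim(3,4) h by (auto simp: dist_real_def)
      then have "(\<phi> t h - c) / t \<le> M + 1" "(\<psi> t h - d) / t \<ge> - (N + 1)"
        using M(2)[OF h] N(2)[OF h] by linarith+
      then have "\<phi> t h - c \<le> (M + 1) * t" "\<psi> t h - d \<ge> - (N + 1) * t"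
        using elim(2) by (auto simp: field_simps)
      moreover have "t * (M + N + 2) < d - c"
        using elim(1) M N by (simp add: pos_less_divide_eq)
      ultimately show "\<phi> t h \<le> \<psi> t h" by (simp add: algebra_simps)
    qed
  qed
qed

text \<open>If \<open>c\<close> and \<open>d\<close> differ, the function with the larger value is
  the maximum near 0. If they agree, the quotient of the maximum is the maximum of the quotients,
  and \<open>max\<close> preserves uniform closeness.\<close>

lemma unif_rdiff_max:
  assumes "unif_rdiff B \<phi> c" and "unif_rdiff B \<psi> d"
  shows "unif_rdiff B (\<lambda>t h. max (\<phi> t h) (\<psi> t h)) (max c d)"
proof (cases c d rule: linorder_cases)
  case less
  have "unif_rdiff B (\<lambda>t h. max (\<phi> t h) (\<psi> t h)) d"
    by (rule unif_rdiff_cong[OF assms(2)], use unif_rdiff_eventually_le[OF assms less] in eventually_elim)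
       (auto simp: max_def)
  with less show ?thesis by (simp add: max_def)
next
  case greater
  have "unif_rdiff B (\<lambda>t h. max (\<phi> t h) (\<psi> t h)) c"
    by (rule unif_rdiff_cong[OF assms(1)], use unif_rdiff_eventually_le[OF assms(2,1) greater] in eventually_elim)
       (auto simp: max_def)
  with greater show ?thesis by (simp add: max_def)
next
  case equal
  obtain D where D: "bounded (D ` B)" "uniform_limit B (\<lambda>t h. (\<phi> t h - c) / t) D (at_right 0)"
    using assms(1) by (auto simp: unif_rdiff_def)
  obtain E where E: "bounded (E ` B)" "uniform_limit B (\<lambda>t h. (\<psi> t h - d) / t) E (at_right 0)"
    using assms(2) by (auto simp: unif_rdiff_def)
  obtain M N where "\<And>h. h \<in> B \<Longrightarrow> \<bar>D h\<bar> \<le> M" "\<And>h. h \<in> B \<Longrightarrow> \<bar>E h\<bar> \<le> N"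
    using D(1) E(1) unfolding bounded_iff by auto
  then have "bounded ((\<lambda>h. max (D h) (E h)) ` B)"
    by (intro boundedI[of _ "max M N"]) (fastforce simp: max_def abs_if split: if_splits)
  moreover have "uniform_limit B (\<lambda>t h. (max (\<phi> t h) (\<psi> t h) - max c d) / t)
      (\<lambda>h. max (D h) (E h)) (at_right 0)"
  proof (rule uniform_limitI)
    fix e :: real assume e: "e > 0"
    have "\<forall>\<^sub>F t::real in at_right 0. 0 < t" by (rule eventually_at_right_less)
    with uniform_limitD[OF D(2) e] uniform_limitD[OF E(2) e]
    show "\<forall>\<^sub>F t in at_right 0. \<forall>h\<in>B.
        dist ((max (\<phi> t h) (\<psi> t h) - max c d) / t) (max (D h) (E h)) < e"
    proof eventually_elim
      case (elim t)
      show ?case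
      proof
        fix h assume h: "h \<in> B"
        have "(max (\<phi> t h) (\<psi> t h) - max c d) / t = max ((\<phi> t h - c) / t) ((\<psi> t h - d) / t)"
          using elim(3) equal by (auto simp: max_def divide_le_cancel)
        then show "dist ((max (\<phi> t h) (\<psi> t h) - max c d) / t) (max (D h) (E h)) < e"
          using elim(1,2) h by (fastforce simp: dist_real_def max_def abs_if split: if_splits)
      qed
    qed
  qed
  ultimately show ?thesis by (auto simp: unif_rdiff_def)
qed

lemma unif_rdiff_Max:
  assumes "finite I" and "I \<noteq> {}" and "\<And>i. i \<in> I \<Longrightarrow> unif_rdiff B (\<phi> i) (c i)"
  shows "unif_rdiff B (\<lambda>t h. Max ((\<lambda>i. \<phi> i t h) ` I)) (Max (c ` I))"
  using assms
proof (induction I rule: finite_ne_induct)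
  case (singleton i)
  then show ?case by simp
next
  case (insert i I)
  have "unif_rdiff B (\<lambda>t h. max (\<phi> i t h) (Max ((\<lambda>i. \<phi> i t h) ` I))) (max (c i) (Max (c ` I)))"
    by (rule unif_rdiff_max) (use insert in auto)
  with insert show ?case by simp
qed

text \<open>The remainder of a Frechet derivative is small relative to the norm of the increment,
  hence uniformly small over directions in the unit ball.\<close>

lemma unif_rdiff_has_derivative:
  fixes N :: "'a::real_normed_vector \<Rightarrow> real"
  assumes N: "(N has_derivative N') (at a)"
  shows "unif_rdiff (cball 0 1) (\<lambda>t v. N (a + t *\<^sub>R v)) (N a)"
proof -
  interpret bounded_linear N' using N by (rule has_derivative_bounded_linear)
  obtain K where K: "\<And>x. norm (N' x) \<le> norm x * K" "K > 0" using pos_bounded by blast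
  have "bounded (N' ` cball 0 1)"
  proof (rule boundedI)
    fix y assume "y \<in> N' ` cball 0 1"
    then obtain v where v: "y = N' v" "norm v \<le> 1" by auto
    show "norm y \<le> K" using order_trans[OF K(1)[of v]] mult_right_mono[OF v(2), of K] K(2) v(1) by simp
  qed
  moreover have "uniform_limit (cball 0 1) (\<lambda>t v. (N (a + t *\<^sub>R v) - N a) / t) N' (at_right 0)"
  proof (rule uniform_limitI)
    fix e :: real assume e: "e > 0"
    then obtain d where d: "d > 0"
      "\<And>y. norm (y - a) < d \<Longrightarrow> norm (N y - N a - N' (y - a)) \<le> e / 2 * norm (y - a)"
      using N unfolding has_derivative_at_alt by (meson half_gt_zero)
    have "\<forall>\<^sub>F t in at_right 0. 0 < t \<and> t < d"
      using d(1) by (auto simp: eventually_at_right_field)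
    then show "\<forall>\<^sub>F t in at_right 0. \<forall>v\<in>cball 0 1. dist ((N (a + t *\<^sub>R v) - N a) / t) (N' v) < e"
    proof eventually_elim
      case (elim t)
      show ?case
      proof
        fix v :: 'a assume v: "v \<in> cball 0 1"
        have n: "norm (t *\<^sub>R v) \<le> t" using v elim by (simp add: mult_le_cancel_left1)
        have "\<bar>N (a + t *\<^sub>R v) - N a - N' (t *\<^sub>R v)\<bar> \<le> e / 2 * norm (t *\<^sub>R v)"
        proof -
          have "norm (t *\<^sub>R v) < d" using n elim by linarith
          with d(2)[of "a + t *\<^sub>R v"] show ?thesis by simp
        qed
        also have "\<dots> \<le> e / 2 * t" using n e by (intro mult_left_mono) auto
        also have "\<dots> < e * t" using e elim by simp
        finally have *: "\<bar>N (a + t *\<^sub>R v) - N a - t * N' v\<bar> < e * t" by (simp add: scaleR)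
        have "\<bar>(N (a + t *\<^sub>R v) - N a) / t - N' v\<bar> = \<bar>N (a + t *\<^sub>R v) - N a - t * N' v\<bar> / t"
          using elim abs_divide[of "N (a + t *\<^sub>R v) - N a - t * N' v" t]
          by (simp add: diff_divide_distrib)
        with * elim show "dist ((N (a + t *\<^sub>R v) - N a) / t) (N' v) < e"
          by (simp add: dist_real_def pos_divide_less_eq)
      qed
    qed
  qed
  ultimately show ?thesis by (auto simp: unif_rdiff_def)
qed

text \<open>Serves the base point 0, where the difference quotient of a norm along each ray does not
  depend on \<open>t\<close>.\<close>

lemma unif_rdiff_homogeneous:
  assumes "\<And>t h. t > 0 \<Longrightarrow> h \<in> B \<Longrightarrow> \<phi> t h = t * N h" and "\<And>h. h \<in> B \<Longrightarrow> \<bar>N h\<bar> \<le> 1"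
  shows "unif_rdiff B \<phi> 0"
proof -
  have "bounded (N ` B)" by (rule boundedI[of _ 1]) (use assms(2) in auto)
  moreover have "uniform_limit B (\<lambda>t h. (\<phi> t h - 0) / t) N (at_right 0)"
  proof (rule uniform_limitI)
    fix e :: real assume "e > 0"
    with eventually_at_right_less[of "0::real"]
    show "\<forall>\<^sub>F t in at_right 0. \<forall>h\<in>B. dist ((\<phi> t h - 0) / t) (N h) < e"
      by (auto elim!: eventually_mono simp: assms(1))
  qed
  ultimately show ?thesis by (auto simp: unif_rdiff_def)
qed

section \<open>The supremum norm and the weighted norm\<close>

text \<open>The closed ball of radius \<open>K\<close> in l_infinity. An explicit bound makes the
  supremum in \<open>supn\<close> and the series in \<open>wsq\<close> meaningful, also for
  sequences not known to lie in \<open>c0\<close>.\<close>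

definition bounded_by :: "real \<Rightarrow> (nat \<Rightarrow> 'k::real_normed_field) set" where
  "bounded_by K = {x. \<forall>i. norm (x i) \<le> K}"

lemma mem_bounded_by [simp]: "x \<in> bounded_by K \<longleftrightarrow> (\<forall>i. norm (x i) \<le> K)"
  by (simp add: bounded_by_def)

definition wsq :: "(nat \<Rightarrow> 'k::real_normed_field) \<Rightarrow> real" where
  "wsq z = (\<Sum>i. norm (z i) ^ 2 / 2 ^ Suc i)"

lemma Znorm_wsq: "Znorm z = supn z + sqrt (wsq z)"
  by (simp add: Znorm_def wsq_def)

lemma c0_bounded_by:
  assumes "x \<in> c0" obtains K where "K > 0" "x \<in> bounded_by K"
proof -
  have "Bseq x" using assms by (auto simp: c0_def intro: convergent_imp_Bseq convergentI)
  then show ?thesis using that by (auto simp: Bseq_def)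
qed

lemma norm_le_supn:
  assumes "x \<in> bounded_by K" shows "norm (x i) \<le> supn x"
  unfolding supn_def by (rule cSUP_upper) (use assms in \<open>auto intro!: bdd_aboveI[of _ K]\<close>)

lemma supn_le: "x \<in> bounded_by K \<Longrightarrow> supn x \<le> K"
  unfolding supn_def by (rule cSUP_least) auto

lemma supn_nonneg: "x \<in> bounded_by K \<Longrightarrow> 0 \<le> supn x"
  using norm_le_supn[of x K 0] norm_ge_zero[of "x 0"] by linarith

lemma supn_scale:
  assumes "x \<in> bounded_by K" shows "supn (\<lambda>i. c * x i) = norm c * supn x"
proof (rule antisym)
  show le: "supn (\<lambda>i. c * x i) \<le> norm c * supn x"
    by (rule supn_le) (auto simp: norm_mult intro!: mult_left_mono norm_le_supn[OF assms])
  show "norm c * supn x \<le> supn (\<lambda>i. c * x i)"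
  proof (cases "c = 0")
    case True
    then show ?thesis by (simp add: supn_def)
  next
    case False
    have cx: "(\<lambda>i. c * x i) \<in> bounded_by (norm c * K)"
      using assms by (auto simp: norm_mult intro!: mult_left_mono)
    have "supn x \<le> supn (\<lambda>i. c * x i) / norm c"
    proof (rule supn_le, unfold mem_bounded_by, rule allI)
      fix i
      show "norm (x i) \<le> supn (\<lambda>i. c * x i) / norm c"
        using norm_le_supn[OF cx, of i] False by (simp add: norm_mult field_simps)
    qed
    with False show ?thesis by (simp add: field_simps)
  qed
qed

lemma summable_weighted:
  fixes u :: "nat \<Rightarrow> real"
  assumes "\<And>i. \<bar>u i\<bar> \<le> K"
  shows "summable (\<lambda>i. u i / 2 ^ Suc i)"
proof (rule summable_comparison_test')
  show "summable (\<lambda>i. K * (1 / 2) ^ Suc i)"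
    by (intro summable_mult sums_summable[OF power_half_series])
  show "norm (u i / 2 ^ Suc i) \<le> K * (1 / 2) ^ Suc i" if "i \<ge> 0" for i
    using assms[of i] by (simp add: power_one_over divide_right_mono field_simps)
qed

lemma summable_wsq:
  assumes "z \<in> bounded_by K" shows "summable (\<lambda>i. norm (z i) ^ 2 / 2 ^ Suc i)"
  by (rule summable_weighted[of _ "K ^ 2"]) (use assms in \<open>auto intro!: power_mono\<close>)

lemma wsq_nonneg: "z \<in> bounded_by K \<Longrightarrow> 0 \<le> wsq z"
  unfolding wsq_def by (rule suminf_nonneg[OF summable_wsq]) auto

lemma wsq_le:
  assumes "z \<in> bounded_by K" shows "wsq z \<le> K ^ 2"
proof -
  have "wsq z \<le> (\<Sum>i. K ^ 2 * (1 / 2) ^ Suc i)"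
    unfolding wsq_def
  proof (rule suminf_le)
    show "summable (\<lambda>i. K\<^sup>2 * (1 / 2) ^ Suc i)"
      by (intro summable_mult sums_summable[OF power_half_series])
    show "(norm (z i))\<^sup>2 / 2 ^ Suc i \<le> K\<^sup>2 * (1 / 2) ^ Suc i" for i
      using assms by (simp add: power_one_over divide_right_mono power_mono)
  qed (rule summable_wsq[OF assms])
  also have "\<dots> = K ^ 2" using sums_mult[OF power_half_series, of "K^2"] by (simp add: sums_iff)
  finally show ?thesis .
qed

lemma wsq_scale:
  assumes "z \<in> bounded_by K" shows "wsq (\<lambda>i. c * z i) = norm c ^ 2 * wsq z"
  unfolding wsq_def
  by (subst suminf_mult[OF summable_wsq[OF assms], symmetric]) (simp add: norm_mult power_mult_distrib)

lemma wsq_two_le: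
  assumes "z \<in> bounded_by K" and "n \<noteq> 0"
  shows "norm (z 0) ^ 2 / 2 + norm (z n) ^ 2 / 2 ^ Suc n \<le> wsq z"
proof -
  have "(\<Sum>i\<in>{0, n}. norm (z i) ^ 2 / 2 ^ Suc i) \<le> wsq z"
    unfolding wsq_def by (rule sum_le_suminf[OF summable_wsq[OF assms(1)]]) auto
  with assms(2) show ?thesis by simp
qed

lemma wsq_pos:
  assumes "z \<in> bounded_by K" and "z i \<noteq> 0" shows "0 < wsq z"
  unfolding wsq_def
  by (rule suminf_pos2[OF summable_wsq[OF assms(1)], of i]) (use assms(2) in auto)

section \<open>Strong subdifferentiability\<close>

text \<open>Since \<open>y\<close> tends to 0, only finitely many entries exceed half of the
  supremum, and a small perturbation attains its supremum among them. These entries are nonzero, and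
  away from 0 the scalar norm, which comes from a real inner product, is differentiable.\<close>

lemma unif_rdiff_supn:
  fixes y :: "nat \<Rightarrow> 'k::{real_normed_field, real_inner}"
  assumes y: "y \<in> c0"
  shows "unif_rdiff (bounded_by 1) (\<lambda>t h. supn (\<lambda>i. y i + of_real t * h i)) (supn y)"
proof (cases "\<exists>j. y j \<noteq> 0")
  case False
  then have y0: "y i = 0" for i by blast
  then have "supn y = 0" by (simp add: supn_def)
  moreover have "unif_rdiff (bounded_by 1) (\<lambda>t h. supn (\<lambda>i. y i + of_real t * h i)) 0"
  proof (rule unif_rdiff_homogeneous)
    show "supn (\<lambda>i. y i + of_real t * h i) = t * supn h" if "t > 0" "h \<in> bounded_by 1" for t and h :: "nat \<Rightarrow> 'k"
      using supn_scale[OF that(2), of "of_real t"] that(1) by (simp add: y0)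
    show "\<bar>supn h\<bar> \<le> 1" if "h \<in> bounded_by 1" for h :: "nat \<Rightarrow> 'k"
      using supn_le[OF that] supn_nonneg[OF that] by simp
  qed
  ultimately show ?thesis by simp
next
  case True
  then obtain j where j: "y j \<noteq> 0" by blast
  obtain K where K: "y \<in> bounded_by K" using y by (rule c0_bounded_by)
  define m where "m = supn y"
  have le_m: "norm (y i) \<le> m" for i unfolding m_def by (rule norm_le_supn[OF K])
  have m: "m > 0" using j le_m[of j] by (smt (verit) zero_less_norm_iff)
  define I where "I = {i. m / 2 < norm (y i)}"
  have "\<forall>\<^sub>F i in sequentially. norm (y i) < m / 2"
    using y m tendstoD[of y 0 sequentially "m / 2"] by (auto simp: c0_def)
  then obtain n0 where "\<And>i. i \<ge> n0 \<Longrightarrow> norm (y i) < m / 2"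
    by (auto simp: eventually_sequentially)
  then have "I \<subseteq> {..<n0}" unfolding I_def by (metis (mono_tags) lessThan_iff linorder_not_less mem_Collect_eq order_less_asym subsetI)
  then have fin: "finite I" by (rule finite_subset) simp
  have "\<exists>i. m / 2 < norm (y i)"
  proof (rule ccontr)
    assume "\<not> ?thesis"
    then have "supn y \<le> m / 2" by (intro supn_le) (auto simp: not_less)
    with m show False by (simp add: m_def)
  qed
  then have ne: "I \<noteq> {}" by (auto simp: I_def)
  have ni: "norm (y i) \<le> m / 2" if "i \<notin> I" for i using that by (simp add: I_def)
  \<comment> \<open>A perturbation of size below \<open>m / 8\<close> keeps some entry with index in
    \<open>I\<close> above \<open>3 * m / 4\<close>, while all entries outside \<open>I\<close> stay
    below \<open>5 * m / 8\<close>.\<close>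
  have key: "supn (\<lambda>i. y i + of_real t * h i) = Max ((\<lambda>i. norm (y i + t *\<^sub>R h i)) ` I)"
    if t: "0 \<le> t" "t < m / 8" and h: "h \<in> bounded_by 1" for t and h :: "nat \<Rightarrow> 'k"
  proof -
    have th: "norm (t *\<^sub>R h i) \<le> t" for i using h t by (simp add: mult_left_le)
    have up: "norm (y i + t *\<^sub>R h i) \<le> norm (y i) + t" for i
      using norm_triangle_ineq[of "y i" "t *\<^sub>R h i"] th[of i] by linarith
    have lo: "norm (y i + t *\<^sub>R h i) \<ge> norm (y i) - t" for i
      using norm_diff_ineq[of "y i" "t *\<^sub>R h i"] th[of i] by linarith
    have "\<exists>i. 7 * m / 8 < norm (y i)"
    proof (rule ccontr)
      assume "\<not> ?thesis"
      then have "supn y \<le> 7 * m / 8" by (intro supn_le) (auto simp: not_less)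
      with m show False by (simp add: m_def)
    qed
    then obtain k where k: "7 * m / 8 < norm (y k)" by blast
    then have kI: "k \<in> I" using m by (simp add: I_def)
    have bd: "(\<lambda>i. y i + t *\<^sub>R h i) \<in> bounded_by (m + t)"
      unfolding mem_bounded_by using up le_m add_right_mono order_trans by blast
    have "supn (\<lambda>i. y i + t *\<^sub>R h i) = Max ((\<lambda>i. norm (y i + t *\<^sub>R h i)) ` I)"
    proof (rule antisym)
      show "supn (\<lambda>i. y i + t *\<^sub>R h i) \<le> Max ((\<lambda>i. norm (y i + t *\<^sub>R h i)) ` I)"
      proof (rule supn_le, unfold mem_bounded_by, rule allI)
        fix i
        show "norm (y i + t *\<^sub>R h i) \<le> Max ((\<lambda>i. norm (y i + t *\<^sub>R h i)) ` I)"
        proof (cases "i \<in> I")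
          case True
          with fin show ?thesis by (intro Max_ge) auto
        next
          case False
          have "norm (y i + t *\<^sub>R h i) \<le> norm (y k + t *\<^sub>R h k)"
            using up[of i] lo[of k] ni[OF False] k t by linarith
          also have "\<dots> \<le> Max ((\<lambda>i. norm (y i + t *\<^sub>R h i)) ` I)"
            using fin kI by (intro Max_ge) auto
          finally show ?thesis .
        qed
      qed
      show "Max ((\<lambda>i. norm (y i + t *\<^sub>R h i)) ` I) \<le> supn (\<lambda>i. y i + t *\<^sub>R h i)"
        using fin ne norm_le_supn[OF bd] by (auto simp: Max_le_iff)
    qed
    then show ?thesis by (simp add: scaleR_conv_of_real)
  qed
  have "unif_rdiff (bounded_by 1) (\<lambda>t h. norm (y i + t *\<^sub>R h i)) (norm (y i))" if "i \<in> I" for i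
  proof -
    have "y i \<noteq> 0" using that m by (auto simp: I_def)
    then have "unif_rdiff (cball 0 1) (\<lambda>t v. norm (y i + t *\<^sub>R v)) (norm (y i))"
      by (intro unif_rdiff_has_derivative[OF has_derivative_norm])
    then show ?thesis
      by (rule unif_rdiff_compose[where g = "\<lambda>h. h i"]) auto
  qed
  then have "unif_rdiff (bounded_by 1) (\<lambda>t h. Max ((\<lambda>i. norm (y i + t *\<^sub>R h i)) ` I)) (Max ((\<lambda>i. norm (y i)) ` I))"
    by (rule unif_rdiff_Max[OF fin ne])
  \<comment> \<open>The zero perturbation is an instance of \<open>key\<close>; it identifies the
    finite maximum at the base point.\<close>
  moreover have "Max ((\<lambda>i. norm (y i)) ` I) = supn y"
    using key[of 0 "\<lambda>_. 0"] m by simp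
  moreover have "\<forall>\<^sub>F t in at_right 0. 0 \<le> t \<and> t < m / 8"
    using m by (auto simp: eventually_at_right_field intro!: exI[of _ "m / 8"])
  then have "\<forall>\<^sub>F t in at_right 0. \<forall>h\<in>bounded_by 1.
      supn (\<lambda>i. y i + of_real t * h i) = Max ((\<lambda>i. norm (y i + t *\<^sub>R h i)) ` I)"
    by (rule eventually_mono) (use key in blast)
  ultimately show ?thesis using unif_rdiff_cong by simp
qed

section \<open>The weighted Hilbert norm\<close>

text \<open>Bounded inner products make the mixed series converge. Nonnegativity of this quadratic
  polynomial in \<open>t\<close> gives Cauchy-Schwarz, and its linear coefficient gives the
  derivative of the square root.\<close>

lemma wsq_add:
  fixes z h :: "nat \<Rightarrow> 'k::{real_normed_field, real_inner}"
  assumes z: "z \<in> bounded_by K" and h: "h \<in> bounded_by L"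
  shows "wsq (\<lambda>i. z i + of_real t * h i)
    = wsq z + 2 * t * (\<Sum>i. inner (z i) (h i) / 2 ^ Suc i) + t ^ 2 * wsq h"
proof -
  have zK: "norm (z i) \<le> K" and hL: "norm (h i) \<le> L" for i using z h by auto
  have b: "\<bar>inner (z i) (h i)\<bar> \<le> K * L" for i
    using Cauchy_Schwarz_ineq2[of "z i" "h i"] mult_mono[OF zK hL, of i i] norm_ge_zero[of "z i"] zK[of i]
    by (smt (verit) norm_ge_zero)
  note s = summable_weighted[of "\<lambda>i. inner (z i) (h i)", OF b]
  have "norm (z i + of_real t * h i) ^ 2 / 2 ^ Suc i = norm (z i) ^ 2 / 2 ^ Suc i
      + (2 * t) * (inner (z i) (h i) / 2 ^ Suc i) + t ^ 2 * (norm (h i) ^ 2 / 2 ^ Suc i)" for i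
  proof -
    have "norm (z i + of_real t * h i) ^ 2 = norm (z i) ^ 2 + 2 * t * inner (z i) (h i) + t ^ 2 * norm (h i) ^ 2"
      unfolding scaleR_conv_of_real[symmetric] power2_norm_eq_inner
      by (simp add: inner_add_left inner_add_right inner_commute power2_eq_square)
    then show ?thesis by (simp add: add_divide_distrib)
  qed
  then show ?thesis
    unfolding wsq_def
    using summable_wsq[OF z] summable_wsq[OF h] s
    by (simp add: suminf_add[symmetric] suminf_mult[symmetric] summable_add summable_mult
          del: power_Suc times_divide_eq_right)
qed

text \<open>At a nonzero point the derivative is \<open>b h / w\<close>. Cauchy-Schwarz keeps the
  square root above its tangent line, and \<open>wsq h \<le> 1\<close> keeps it at most
  \<open>t ^ 2 / (2 * w)\<close> higher, a bound independent of \<open>h\<close>.\<close>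

lemma unif_rdiff_wsq:
  fixes z :: "nat \<Rightarrow> 'k::{real_normed_field, real_inner}"
  assumes z: "z \<in> bounded_by K"
  shows "unif_rdiff (bounded_by 1) (\<lambda>t h. sqrt (wsq (\<lambda>i. z i + of_real t * h i))) (sqrt (wsq z))"
proof (cases "\<exists>j. z j \<noteq> 0")
  case False
  then have z0: "z i = 0" for i by blast
  then have "wsq z = 0" by (simp add: wsq_def)
  moreover have "unif_rdiff (bounded_by 1) (\<lambda>t h. sqrt (wsq (\<lambda>i. z i + of_real t * h i))) 0"
  proof (rule unif_rdiff_homogeneous)
    show "sqrt (wsq (\<lambda>i. z i + of_real t * h i)) = t * sqrt (wsq h)"
      if "t > 0" "h \<in> bounded_by 1" for t and h :: "nat \<Rightarrow> 'k"
      using wsq_scale[OF that(2), of "of_real t"] that(1) by (simp add: z0 real_sqrt_mult)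
    show "\<bar>sqrt (wsq h)\<bar> \<le> 1" if "h \<in> bounded_by 1" for h :: "nat \<Rightarrow> 'k"
      using wsq_le[OF that] wsq_nonneg[OF that] by simp
  qed
  ultimately show ?thesis by simp
next
  case True
  then have q: "wsq z > 0" using wsq_pos[OF z] by blast
  define w where "w = sqrt (wsq z)"
  have w: "w > 0" "w ^ 2 = wsq z" using q by (auto simp: w_def)
  define b where "b h = (\<Sum>i. inner (z i) (h i) / 2 ^ Suc i)" for h
  have CS: "(b h / w) ^ 2 \<le> wsq h" if h: "h \<in> bounded_by 1" for h :: "nat \<Rightarrow> 'k"
  proof -
    \<comment> \<open>the step at which the norm of \<open>z + s h\<close> being nonnegative becomes Cauchy-Schwarz\<close>
    define s where "s = - (w ^ 2 / b h)"
    show ?thesis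
    proof (cases "b h = 0")
      case True
      with wsq_nonneg[OF h] show ?thesis by simp
    next
      case False
      have "(\<lambda>i. z i + of_real s * h i) \<in> bounded_by (K + \<bar>s\<bar> * 1)"
        using z h by (auto simp: norm_mult intro!: norm_triangle_le add_mono mult_left_le)
      then have "0 \<le> wsq z + 2 * s * b h + s ^ 2 * wsq h"
        unfolding b_def wsq_add[OF z h, of s, symmetric] by (rule wsq_nonneg)
      also have "\<dots> = (w / b h) ^ 2 * w ^ 2 * (wsq h - (b h / w) ^ 2)"
        using False w by (simp add: s_def w(2)[symmetric] field_simps power2_eq_square)
      finally have "0 \<le> (w / b h) ^ 2 * w ^ 2 * (wsq h - (b h / w) ^ 2)" .
      moreover have "(w / b h) ^ 2 * w ^ 2 > 0" using False w(1) by simp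
      ultimately show ?thesis by (simp only: zero_le_mult_iff) linarith
    qed
  qed
  have r1: "wsq h \<le> 1" if "h \<in> bounded_by 1" for h :: "nat \<Rightarrow> 'k"
    using wsq_le[OF that] by simp
  have D1: "\<bar>b h / w\<bar> \<le> 1" if "h \<in> bounded_by 1" for h
    using order_trans[OF CS[OF that] r1[OF that]] by (simp only: abs_square_le_1)
  have main: "0 \<le> (sqrt (wsq (\<lambda>i. z i + of_real t * h i)) - w) / t - b h / w
      \<and> (sqrt (wsq (\<lambda>i. z i + of_real t * h i)) - w) / t - b h / w \<le> t / (2 * w)"
    if t: "t > 0" and h: "h \<in> bounded_by 1" for t h
  proof -
    have eq: "wsq (\<lambda>i. z i + of_real t * h i) = w ^ 2 + 2 * t * b h + t ^ 2 * wsq h"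
      using wsq_add[OF z h] by (simp add: w b_def)
    have "(w + t * (b h / w)) ^ 2 = w ^ 2 + 2 * t * b h + t ^ 2 * (b h / w) ^ 2"
      using w(1) by (simp add: field_simps power2_eq_square)
    also have "\<dots> \<le> w ^ 2 + 2 * t * b h + t ^ 2 * wsq h"
      using CS[OF h] by (intro add_left_mono mult_left_mono) auto
    finally have lo: "w + t * (b h / w) \<le> sqrt (wsq (\<lambda>i. z i + of_real t * h i))"
      unfolding eq by (rule real_le_rsqrt)
    \<comment> \<open>\<open>R\<close> is the arithmetic mean of \<open>w\<close> and
      \<open>q / w\<close> with \<open>q = w ^ 2 + 2 * t * b h + t ^ 2\<close>, an upper bound for
      the perturbed \<open>wsq\<close>. Hence \<open>R ^ 2\<close> is at least \<open>q\<close>,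
      which is the inequality of the means.\<close>
    define R where "R = w + t * (b h / w) + t ^ 2 / (2 * w)"
    have Rw: "2 * w * R = 2 * w ^ 2 + 2 * t * b h + t ^ 2"
      using w(1) by (simp add: R_def field_simps power2_eq_square)
    have "w ^ 2 + 2 * t * b h + t ^ 2 * wsq h \<le> 2 * w * R - w ^ 2"
      using r1[OF h] unfolding Rw by (simp add: mult_left_le)
    also have "\<dots> \<le> R ^ 2"
      using zero_le_power2[of "R - w"] by (simp add: power2_diff mult_ac)
    finally have "w ^ 2 + 2 * t * b h + t ^ 2 * wsq h \<le> R ^ 2" .
    moreover have "R \<ge> 0"
    proof -
      have "\<bar>b h\<bar> \<le> w" using D1[OF h] w(1) by simp
      then have "2 * t * b h \<ge> - (2 * t * w)"
        using mult_left_mono[of "- w" "b h" t] t by (simp add: abs_le_iff)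
      then have "2 * w * R \<ge> (w - t) ^ 2 + w ^ 2"
        unfolding Rw by (simp add: power2_diff)
      then have "2 * w * R \<ge> 0" by (smt (verit) zero_le_power2)
      with w(1) show ?thesis by (simp add: zero_le_mult_iff)
    qed
    ultimately have hi: "sqrt (wsq (\<lambda>i. z i + of_real t * h i)) \<le> R"
      unfolding eq by (rule real_le_lsqrt[rotated])
    define e where "e = sqrt (wsq (\<lambda>i. z i + of_real t * h i)) - w - t * (b h / w)"
    have "0 \<le> e" "e \<le> t ^ 2 / (2 * w)" using lo hi unfolding R_def e_def by linarith+
    then have "0 \<le> e / t" "e / t \<le> t ^ 2 / (2 * w) / t"
      using t divide_right_mono[of e "t ^ 2 / (2 * w)" t] by auto
    moreover have "t ^ 2 / (2 * w) / t = t / (2 * w)" using t by (simp add: power2_eq_square)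
    moreover have "e / t = (sqrt (wsq (\<lambda>i. z i + of_real t * h i)) - w) / t - b h / w"
      using t by (simp add: e_def diff_divide_distrib)
    ultimately show ?thesis by simp
  qed
  have "bounded ((\<lambda>h. b h / w) ` bounded_by 1)"
    by (rule boundedI[of _ 1]) (use D1 in auto)
  moreover have "uniform_limit (bounded_by 1)
      (\<lambda>t h. (sqrt (wsq (\<lambda>i. z i + of_real t * h i)) - w) / t) (\<lambda>h. b h / w) (at_right 0)"
  proof (rule uniform_limitI)
    fix e :: real assume e: "e > 0"
    have "\<forall>\<^sub>F t in at_right 0. 0 < t \<and> t < 2 * w * e"
      using e w(1) by (auto simp: eventually_at_right_field intro!: exI[of _ "2 * w * e"])
    then show "\<forall>\<^sub>F t in at_right 0. \<forall>h\<in>bounded_by 1.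
        dist ((sqrt (wsq (\<lambda>i. z i + of_real t * h i)) - w) / t) (b h / w) < e"
    proof eventually_elim
      case (elim t)
      then have "t / (2 * w) < e" using w(1) by (simp add: field_simps)
      show ?case
      proof
        fix h :: "nat \<Rightarrow> 'k" assume "h \<in> bounded_by 1"
        from main[OF _ this, of t] elim \<open>t / (2 * w) < e\<close>
        show "dist ((sqrt (wsq (\<lambda>i. z i + of_real t * h i)) - w) / t) (b h / w) < e"
          by (simp add: dist_real_def)
      qed
    qed
  qed
  ultimately show ?thesis by (auto simp: unif_rdiff_def w_def)
qed

text \<open>The norm of Z dominates the supremum norm, so both projections map the unit ball of X
  into the direction set used for the component norms.\<close>

lemma ballX_bounded_by:
  assumes "p \<in> ballX" shows "fst p \<in> bounded_by 1" "snd p \<in> bounded_by 1"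
proof -
  obtain K where K: "fst p \<in> bounded_by K"
    using assms by (auto simp: ballX_def Xset_def elim: c0_bounded_by)
  obtain L where L: "snd p \<in> bounded_by L"
    using assms by (auto simp: ballX_def Xset_def elim: c0_bounded_by)
  have le: "supn (fst p) \<le> 1" "supn (snd p) + sqrt (wsq (snd p)) \<le> 1"
    using assms by (auto simp: ballX_def normX_def Znorm_wsq)
  show "fst p \<in> bounded_by 1" using norm_le_supn[OF K] le by (auto intro: order_trans)
  have "supn (snd p) \<le> 1" using le real_sqrt_ge_zero[OF wsq_nonneg[OF L]] by linarith
  then show "snd p \<in> bounded_by 1" using norm_le_supn[OF L] by (auto intro: order_trans)
qed

lemma strongly_subdiff_X: "strongly_subdiff TYPE('k::{real_normed_field, real_inner})"
  unfolding strongly_subdiff_def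
proof
  fix x :: "'k pt" assume x: "x \<in> Xset"
  have c: "fst x \<in> c0" "snd x \<in> c0" using x by (auto simp: Xset_def)
  obtain K where K: "snd x \<in> bounded_by K" using c(2) by (rule c0_bounded_by)
  have "unif_rdiff ballX (\<lambda>t h. normX (addX x (smulX (of_real t) h))) (normX x)"
    unfolding normX_def Znorm_wsq addX_def smulX_def fst_conv snd_conv
  proof (intro unif_rdiff_max unif_rdiff_add)
    have f: "fst ` ballX \<subseteq> (bounded_by 1 :: (nat \<Rightarrow> 'k) set)" using ballX_bounded_by by blast
    have s: "snd ` ballX \<subseteq> (bounded_by 1 :: (nat \<Rightarrow> 'k) set)" using ballX_bounded_by by blast
    show "unif_rdiff ballX (\<lambda>t h. supn (\<lambda>i. fst x i + of_real t * fst h i)) (supn (fst x))"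
      by (rule unif_rdiff_compose[OF unif_rdiff_supn[OF c(1)] f])
    show "unif_rdiff ballX (\<lambda>t h. supn (\<lambda>i. snd x i + of_real t * snd h i)) (supn (snd x))"
      by (rule unif_rdiff_compose[OF unif_rdiff_supn[OF c(2)] s])
    show "unif_rdiff ballX (\<lambda>t h. sqrt (wsq (\<lambda>i. snd x i + of_real t * snd h i))) (sqrt (wsq (snd x)))"
      by (rule unif_rdiff_compose[OF unif_rdiff_wsq[OF K] s])
  qed
  then obtain D where D: "uniform_limit ballX
      (\<lambda>t h. (normX (addX x (smulX (of_real t) h)) - normX x) / t) D (at_right 0)"
    by (auto simp: unif_rdiff_def)
  show "\<exists>D :: 'k pt \<Rightarrow> real. \<forall>\<epsilon>>0. \<exists>\<delta>>0. \<forall>t::real. 0 < t \<and> t < \<delta> \<longrightarrow>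
       (\<forall>h \<in> ballX. \<bar>(normX (addX x (smulX (of_real t) h)) - normX x) / t - D h\<bar> < \<epsilon>)"
  proof (intro exI[of _ D] allI impI)
    fix e :: real assume "e > 0"
    from uniform_limitD[OF D this]
    show "\<exists>\<delta>>0. \<forall>t::real. 0 < t \<and> t < \<delta> \<longrightarrow>
       (\<forall>h \<in> ballX. \<bar>(normX (addX x (smulX (of_real t) h)) - normX x) / t - D h\<bar> < e)"
      by (auto simp: eventually_at_right_field dist_real_def)
  qed
qed


section \<open>Failure of the property\<close>

lemma Xset_bounded_by:
  assumes "p \<in> Xset" obtains K where "fst p \<in> bounded_by K" "snd p \<in> bounded_by K"
proof -
  obtain K L where "fst p \<in> bounded_by K" "snd p \<in> bounded_by L"
    using assms by (metis Xset_def c0_bounded_by mem_Times_iff)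
  then have "fst p \<in> bounded_by (max K L)" "snd p \<in> bounded_by (max K L)"
    by (auto intro: max.coboundedI1 max.coboundedI2)
  then show ?thesis by (rule that)
qed

lemma addX_Xset: "p \<in> Xset \<Longrightarrow> q \<in> Xset \<Longrightarrow> addX p q \<in> Xset"
  by (auto simp: Xset_def addX_def c0_def intro: tendsto_add_zero)

lemma smulX_Xset: "p \<in> Xset \<Longrightarrow> smulX c p \<in> Xset"
  by (auto simp: Xset_def smulX_def c0_def intro: tendsto_mult_right_zero)

lemma normX_smulX:
  assumes "p \<in> Xset" shows "normX (smulX c p) = norm c * normX p"
proof -
  obtain K where K: "fst p \<in> bounded_by K" "snd p \<in> bounded_by K"
    using assms by (rule Xset_bounded_by)
  show ?thesis
    using supn_scale[OF K(1), of c] supn_scale[OF K(2), of c] wsq_scale[OF K(2), of c]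
    by (simp add: normX_def Znorm_wsq smulX_def real_sqrt_mult max_mult_distrib_left distrib_left)
qed

lemma Znorm_le_normX: "Znorm (snd p) \<le> normX p"
  by (simp add: normX_def)

lemma norm_fst_le_normX:
  assumes "p \<in> Xset" shows "norm (fst p i) \<le> normX p"
  using assms norm_le_supn[of "fst p" _ i] unfolding normX_def
  by (metis Xset_bounded_by max.coboundedI1)

lemma norm_snd_le_normX:
  assumes "p \<in> Xset" shows "norm (snd p i) \<le> normX p"
proof -
  obtain K where K: "snd p \<in> bounded_by K" using assms by (rule Xset_bounded_by)
  show ?thesis
    using norm_le_supn[OF K, of i] real_sqrt_ge_zero[OF wsq_nonneg[OF K]] Znorm_le_normX[of p]
    unfolding Znorm_wsq by linarith
qed

lemma normX_nonneg: "p \<in> Xset \<Longrightarrow> 0 \<le> normX p"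
  using norm_fst_le_normX[of p 0] norm_ge_zero order_trans by blast

text \<open>The weights of the Hilbert part sum to 1, so the norm of Z is at most twice the supremum
  norm.\<close>

lemma normX_le:
  assumes "fst p \<in> bounded_by K" "snd p \<in> bounded_by K" shows "normX p \<le> 2 * K"
proof -
  have K: "0 \<le> K" using assms(1) norm_ge_zero order_trans unfolding mem_bounded_by by blast
  have "sqrt (wsq (snd p)) \<le> K" using wsq_le[OF assms(2)] K by (simp add: real_le_lsqrt)
  with supn_le[OF assms(1)] supn_le[OF assms(2)] K show ?thesis
    unfolding normX_def Znorm_wsq by simp
qed

lemma zero_ballX: "((\<lambda>_. 0), (\<lambda>_. 0)) \<in> ballX"
  by (simp add: ballX_def Xset_def c0_def normX_def Znorm_def supn_def)

text \<open>The bound in \<open>dualX\<close> makes the supremum in \<open>dnorm\<close> a genuine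
  one and settles points of norm 0; any other point is scaled into the unit ball.\<close>

lemma PiX_norm_le:
  assumes "(x, f) \<in> PiX" and p: "p \<in> Xset" shows "norm (f p) \<le> normX p"
proof -
  have f: "dualX f" "dnorm f = 1" using assms by (auto simp: PiX_def)
  obtain C where C: "\<And>p. p \<in> Xset \<Longrightarrow> norm (f p) \<le> C * normX p"
    using f(1) unfolding dualX_def by blast
  have ball: "norm (f q) \<le> 1" if "q \<in> ballX" for q
  proof -
    have "norm (f q) \<le> \<bar>C\<bar>" if "q \<in> ballX" for q
    proof -
      have q: "q \<in> Xset" "normX q \<le> 1" using that by (auto simp: ballX_def)
      have "norm (f q) \<le> \<bar>C\<bar> * normX q"
        using C[OF q(1)] mult_right_mono[OF abs_ge_self normX_nonneg[OF q(1)], of C] by linarith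
      with q show ?thesis by (meson abs_ge_zero mult_left_le order_trans)
    qed
    then have "bdd_above ((\<lambda>q. norm (f q)) ` ballX)" by (intro bdd_aboveI[of _ "\<bar>C\<bar>"]) auto
    from cSUP_upper[OF that this] f(2) show ?thesis by (simp add: dnorm_def)
  qed
  show ?thesis
  proof (cases "normX p = 0")
    case True
    with C[OF p] show ?thesis by simp
  next
    case False
    define r where "r = normX p"
    have r: "r > 0" using False normX_nonneg[OF p] by (simp add: r_def)
    have "smulX (of_real (1 / r)) p \<in> ballX"
      unfolding ballX_def using r p by (simp add: smulX_Xset normX_smulX r_def del: of_real_divide)
    from ball[OF this] f(1) p have "norm (of_real (1 / r) * f p) \<le> 1"
      by (simp add: dualX_def)
    with r show ?thesis by (simp add: norm_mult norm_divide r_def field_simps)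
  qed
qed

lemma opX_bound:
  assumes "opX T" obtains C where "\<And>p. p \<in> ballX \<Longrightarrow> normX (T p) \<le> C"
proof -
  obtain C where C: "\<And>p. p \<in> Xset \<Longrightarrow> normX (T p) \<le> C * normX p"
    using assms unfolding opX_def by blast
  have "normX (T p) \<le> \<bar>C\<bar>" if "p \<in> ballX" for p
  proof -
    have p: "p \<in> Xset" "normX p \<le> 1" using that by (auto simp: ballX_def)
    have "normX (T p) \<le> \<bar>C\<bar> * normX p"
      using C[OF p(1)] mult_right_mono[OF abs_ge_self normX_nonneg[OF p(1)], of C] by linarith
    with p show ?thesis by (meson abs_ge_zero mult_left_le order_trans)
  qed
  then show ?thesis by (rule that)
qed

lemma PiX_ballX: "(x, f) \<in> PiX \<Longrightarrow> x \<in> ballX"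
  by (simp add: PiX_def ballX_def)

lemma opX_Xset: "opX T \<Longrightarrow> p \<in> Xset \<Longrightarrow> T p \<in> Xset"
  by (auto simp: opX_def)

text \<open>States are contractive and \<open>T\<close> is bounded on the unit ball, so the supremum
  in \<open>numrad\<close> is over a set bounded above.\<close>

lemma PiX_le_numrad:
  assumes T: "opX T" and xf: "(x, f) \<in> PiX" shows "norm (f (T x)) \<le> numrad T"
proof -
  obtain C where C: "\<And>p. p \<in> ballX \<Longrightarrow> normX (T p) \<le> C" using T by (rule opX_bound) blast
  have "norm (g (T y)) \<le> C" if yg: "(y, g) \<in> PiX" for y g
  proof -
    have y: "y \<in> ballX" "y \<in> Xset" using PiX_ballX[OF yg] by (auto simp: ballX_def)
    show ?thesis using PiX_norm_le[OF yg opX_Xset[OF T y(2)]] C[OF y(1)] by linarith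
  qed
  then have "bdd_above ((\<lambda>xf. norm (snd xf (T (fst xf)))) ` PiX)"
    by (intro bdd_aboveI[of _ C]) auto
  from cSUP_upper[OF xf this] show ?thesis by (simp add: numrad_def)
qed

lemma opX_smulX:
  assumes T: "opX T" shows "opX (\<lambda>p. smulX c (T p))"
proof -
  obtain C where C: "\<And>p. p \<in> Xset \<Longrightarrow> normX (T p) \<le> C * normX p"
    using T unfolding opX_def by blast
  have "normX (smulX c (T p)) \<le> norm c * C * normX p" if "p \<in> Xset" for p
    using mult_left_mono[OF C[OF that] norm_ge_zero[of c]] opX_Xset[OF T that]
    by (simp add: normX_smulX mult.assoc)
  moreover have "smulX c (addX p q) = addX (smulX c p) (smulX c q)" for p q
    by (simp add: smulX_def addX_def distrib_left)
  moreover have "smulX c (smulX d p) = smulX d (smulX c p)" for d p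
    by (simp add: smulX_def mult.left_commute)
  moreover have "smulX c ` T ` Xset \<subseteq> Xset" using opX_Xset[OF T] smulX_Xset by blast
  ultimately show ?thesis using T unfolding opX_def image_image
    by (intro conjI ballI allI exI[of _ "norm c * C"]) simp_all
qed

lemma numrad_smulX:
  assumes T: "opX (T :: 'k::real_normed_field pt \<Rightarrow> 'k pt)" and r: "r > 0"
    and ne: "(PiX :: ('k pt \<times> ('k pt \<Rightarrow> 'k)) set) \<noteq> {}"
  shows "numrad (\<lambda>p. smulX (of_real r) (T p)) = r * numrad T"
proof -
  let ?T = "\<lambda>p. smulX (of_real r) (T p)"
  have eq: "norm (f (?T x)) = r * norm (f (T x))" if "(x, f) \<in> PiX" for x f
  proof -
    have "dualX f" "T x \<in> Xset" using that opX_Xset[OF T] by (auto simp: PiX_def)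
    with r show ?thesis by (simp add: dualX_def norm_mult)
  qed
  show ?thesis
  proof (rule antisym)
    have "norm (f (?T x)) \<le> r * numrad T" if "(x, f) \<in> PiX" for x f
      unfolding eq[OF that] using PiX_le_numrad[OF T that] r by (intro mult_left_mono) auto
    then show "numrad ?T \<le> r * numrad T"
      unfolding numrad_def[of ?T] by (intro cSUP_least[OF ne]) auto
    have "norm (f (T x)) \<le> numrad ?T / r" if "(x, f) \<in> PiX" for x f
      using PiX_le_numrad[OF opX_smulX[OF T] that, of "of_real r"] eq[OF that] r by (simp add: field_simps)
    then have "numrad T \<le> numrad ?T / r"
      unfolding numrad_def[of T] by (intro cSUP_least[OF ne]) auto
    with r show "r * numrad T \<le> numrad ?T" by (simp add: field_simps)
  qed
qed

text \<open>Turns a discrepancy in one coordinate of the second component into a lower bound for the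
  distance of two operators.\<close>

lemma opnorm_opdiff_ge:
  assumes S: "opX S" and T: "opX T" and p: "p \<in> ballX"
  shows "norm (snd (S p) i - snd (T p) i) \<le> opnorm (opdiff S T)"
proof -
  obtain C where C: "\<And>p. p \<in> ballX \<Longrightarrow> normX (S p) \<le> C" using S by (rule opX_bound) blast
  obtain D where D: "\<And>p. p \<in> ballX \<Longrightarrow> normX (T p) \<le> D" using T by (rule opX_bound) blast
  have le: "normX (opdiff S T q) \<le> 2 * (C + D)" if q: "q \<in> ballX" for q
  proof (rule normX_le)
    have X: "S q \<in> Xset" "T q \<in> Xset" using q opX_Xset[OF S] opX_Xset[OF T] by (auto simp: ballX_def)
    have b: "norm (u - v) \<le> C + D" if "norm u \<le> normX (S q)" "norm v \<le> normX (T q)" for u v :: 'a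
      using norm_triangle_ineq4[of u v] C[OF q] D[OF q] that by linarith
    show "fst (opdiff S T q) \<in> bounded_by (C + D)" "snd (opdiff S T q) \<in> bounded_by (C + D)"
      using b[OF norm_fst_le_normX norm_fst_le_normX] b[OF norm_snd_le_normX norm_snd_le_normX] X
      by (simp_all add: opdiff_def addX_def smulX_def)
  qed
  have "opdiff S T p \<in> Xset"
    using p opX_Xset[OF S] opX_Xset[OF T]
    by (simp add: opdiff_def ballX_def addX_Xset smulX_Xset)
  from norm_snd_le_normX[OF this, of i]
  have "norm (snd (S p) i - snd (T p) i) \<le> normX (opdiff S T p)"
    by (simp add: opdiff_def addX_def smulX_def)
  also have "\<dots> \<le> opnorm (opdiff S T)"
    unfolding opnorm_def by (rule cSUP_upper[OF p]) (use le in \<open>auto intro!: bdd_aboveI[of _ "2 * (C + D)"]\<close>)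
  finally show ?thesis .
qed

section \<open>Two-coordinate sequences and the curve of states\<close>

definition two_seq :: "nat \<Rightarrow> 'k \<Rightarrow> 'k \<Rightarrow> nat \<Rightarrow> 'k::real_normed_field" where
  "two_seq n a b = (\<lambda>i. if i = 0 then a else if i = n then b else 0)"

lemma two_seq_c0: "two_seq n a b \<in> c0"
proof -
  have "\<forall>\<^sub>F i in sequentially. two_seq n a b i = 0"
    unfolding eventually_sequentially two_seq_def by (intro exI[of _ "Suc n"]) auto
  then show ?thesis by (simp add: c0_def tendsto_eventually)
qed

lemma two_seq_bounded_by: "norm a \<le> K \<Longrightarrow> norm b \<le> K \<Longrightarrow> two_seq n a b \<in> bounded_by K"
  using order_trans[OF norm_ge_zero, of a K] by (auto simp: two_seq_def)

lemma supn_two_seq: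
  assumes "norm b \<le> norm a" shows "supn (two_seq n a b) = norm a"
proof (rule antisym)
  note b = two_seq_bounded_by[OF order_refl assms, of n]
  show "supn (two_seq n a b) \<le> norm a" by (rule supn_le[OF b])
  show "norm a \<le> supn (two_seq n a b)" using norm_le_supn[OF b, of 0] by (simp add: two_seq_def)
qed

lemma wsq_two_seq:
  assumes "n \<noteq> 0" shows "wsq (two_seq n a b) = norm a ^ 2 / 2 + norm b ^ 2 / 2 ^ Suc n"
proof -
  have "wsq (two_seq n a b) = (\<Sum>i\<in>{0, n}. norm (two_seq n a b i) ^ 2 / 2 ^ Suc i)"
    unfolding wsq_def by (rule suminf_finite) (auto simp: two_seq_def)
  with assms show ?thesis by (simp add: two_seq_def)
qed

text \<open>The weighted Hilbert norm of e_0 + s e_n for \<open>n \<noteq> 0\<close>; for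
  \<open>\<bar>s\<bar> \<le> 1\<close> the norm of that vector in Z is
  \<open>1 + wrad n s\<close>.\<close>

definition wrad :: "nat \<Rightarrow> real \<Rightarrow> real" where
  "wrad n s = sqrt (1 / 2 + s ^ 2 / 2 ^ Suc n)"

lemma wrad_pos: "wrad n s > 0"
  by (simp add: wrad_def add_pos_nonneg)

lemma wrad_square: "wrad n s ^ 2 = 1 / 2 + s ^ 2 / 2 ^ Suc n"
  by (simp add: wrad_def)

lemma wrad_0: "wrad n 0 = sqrt (1 / 2)"
  by (simp add: wrad_def)

lemma Znorm_two_seq:
  assumes "n \<noteq> 0" and "\<bar>s\<bar> \<le> 1" and "c \<ge> 0"
  shows "Znorm (two_seq n (of_real c) (of_real (c * s) :: 'k::real_normed_field)) = c * (1 + wrad n s)"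
proof -
  have "norm (of_real (c * s) :: 'k) \<le> norm (of_real c :: 'k)"
    unfolding norm_of_real abs_mult using assms(2,3) by (simp add: mult_left_le)
  moreover have "c ^ 2 / 2 + (c * s) ^ 2 / 2 ^ Suc n = c ^ 2 * (1 / 2 + s ^ 2 / 2 ^ Suc n)"
    by (simp add: power_mult_distrib distrib_left)
  then have "sqrt (c ^ 2 / 2 + (c * s) ^ 2 / 2 ^ Suc n) = c * wrad n s"
    using assms(3) by (simp add: wrad_def real_sqrt_mult del: power_Suc)
  ultimately show ?thesis
    using assms by (simp add: Znorm_wsq supn_two_seq wsq_two_seq distrib_left del: of_real_mult power_Suc)
qed

text \<open>The second component is e_0 + s e_n normalised in Z. The parameter \<open>t\<close> is a
  scalar, so that its phase can be chosen freely, whereas \<open>s\<close> is real because it is the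
  variable of differentiation.\<close>

definition pt_curve :: "nat \<Rightarrow> 'k \<Rightarrow> real \<Rightarrow> 'k::real_normed_field pt" where
  "pt_curve n t s =
    (two_seq n 1 t, two_seq n (of_real (1 / (1 + wrad n s))) (of_real (1 / (1 + wrad n s) * s)))"

text \<open>The derivative of the norm of Z at the second component of \<open>pt_curve n t s\<close>.\<close>
definition fn_curve :: "nat \<Rightarrow> real \<Rightarrow> 'k::real_normed_field pt \<Rightarrow> 'k" where
  "fn_curve n s p = of_real (1 + 1 / (2 * wrad n s)) * snd p 0
    + of_real (s / (2 ^ Suc n * wrad n s)) * snd p n"

lemma pt_curve_normed:
  assumes "n \<noteq> 0" "norm t \<le> 1" "\<bar>s\<bar> \<le> 1"
  shows "pt_curve n t s \<in> Xset" "normX (pt_curve n t s) = 1"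
proof -
  show "pt_curve n t s \<in> Xset" by (simp add: pt_curve_def Xset_def two_seq_c0)
  have "1 / (1 + wrad n s) \<ge> 0" "1 / (1 + wrad n s) * (1 + wrad n s) = 1"
    using wrad_pos[of n s] by simp_all
  then have "Znorm (two_seq n (of_real (1 / (1 + wrad n s))) (of_real (1 / (1 + wrad n s) * s)) :: nat \<Rightarrow> 'a) = 1"
    by (simp only: Znorm_two_seq[OF assms(1,3)])
  moreover have "supn (two_seq n 1 t) = 1" using supn_two_seq[of t 1 n] assms by simp
  ultimately show "normX (pt_curve n t s) = 1"
    unfolding normX_def pt_curve_def fst_conv snd_conv by (simp only: max.idem)
qed

text \<open>Euler's identity for a homogeneous function: the weighted terms add up to
  \<open>R ^ 2 / R = R\<close>, and the total \<open>1 + R\<close> cancels the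
  normalisation.\<close>

lemma fn_curve_pt_curve:
  assumes "n \<noteq> 0"
  shows "fn_curve n s (pt_curve n t s) = 1"
proof -
  define R where "R = wrad n s"
  have R: "R > 0" "R ^ 2 = 1 / 2 + s ^ 2 / 2 ^ Suc n" using wrad_pos wrad_square by (auto simp: R_def)
  have "1 / (2 * R) + s * s / (2 ^ Suc n * R) = R ^ 2 / R"
    unfolding R(2) by (simp add: add_divide_distrib power2_eq_square)
  also have "\<dots> = R" using R(1) by (simp add: power2_eq_square)
  finally have "1 + 1 / (2 * R) + s * s / (2 ^ Suc n * R) = 1 + R" by simp
  moreover have "(1 + 1 / (2 * R)) * (1 / (1 + R)) + s / (2 ^ Suc n * R) * (1 / (1 + R) * s)
      = (1 + 1 / (2 * R) + s * s / (2 ^ Suc n * R)) / (1 + R)"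
    by (simp add: add_divide_distrib mult_ac del: power_Suc)
  ultimately have "(1 + 1 / (2 * R)) * (1 / (1 + R)) + s / (2 ^ Suc n * R) * (1 / (1 + R) * s) = 1"
    using R(1) by simp
  moreover have "fn_curve n s (pt_curve n t s)
      = of_real ((1 + 1 / (2 * R)) * (1 / (1 + R)) + s / (2 ^ Suc n * R) * (1 / (1 + R) * s))"
    unfolding fn_curve_def pt_curve_def two_seq_def R_def[symmetric] using assms
    by (simp only: snd_conv of_real_mult of_real_add if_True if_False simp_thms)
  ultimately show ?thesis by (simp only: of_real_1)
qed

text \<open>The functional is the sum of the coordinate at 0, bounded by the supremum norm, and the
  weighted inner product with (e_0 + s e_n) / R, bounded by Cauchy-Schwarz.\<close>

lemma fn_curve_le:
  assumes n: "n \<noteq> 0" and z: "snd p \<in> bounded_by K"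
  shows "norm (fn_curve n s p) \<le> Znorm (snd p)"
proof -
  define R where "R = wrad n s"
  have R: "R > 0" "R ^ 2 = 1 / 2 + s ^ 2 / 2 ^ Suc n" using wrad_pos wrad_square by (auto simp: R_def)
  define a b k where "a = norm (snd p 0)" and "b = norm (snd p n)" and "k = (1::real) / 2 ^ Suc n"
  have k: "k > 0" by (simp add: k_def)
  have "\<bar>1 + 1 / (2 * R)\<bar> = 1 + 1 / (2 * R)" "\<bar>s / (2 ^ Suc n * R)\<bar> = \<bar>s\<bar> * k / R"
    using R(1) by (simp_all add: k_def abs_mult)
  then have "norm (fn_curve n s p) \<le> (1 + 1 / (2 * R)) * a + \<bar>s\<bar> * k / R * b"
    unfolding fn_curve_def R_def[symmetric]
    by (intro norm_triangle_le) (simp only: norm_mult norm_of_real a_def b_def order_refl)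
  also have "\<dots> = a + (a / 2 + \<bar>s\<bar> * k * b) / R"
    using R(1) by (simp add: field_simps)
  also have "\<dots> \<le> supn (snd p) + sqrt (wsq (snd p))"
  proof (rule add_mono)
    show "a \<le> supn (snd p)" unfolding a_def by (rule norm_le_supn[OF z])
    \<comment> \<open>Lagrange's identity: the defect in the two-term Cauchy-Schwarz inequality is a
      square.\<close>
    have "(1 / 2 + s ^ 2 * k) * (a ^ 2 / 2 + b ^ 2 * k) - (a / 2 + \<bar>s\<bar> * k * b) ^ 2
        = k / 2 * (\<bar>s\<bar> * a - b) ^ 2"
      by (simp add: algebra_simps power2_eq_square)
    moreover have "k / 2 * (\<bar>s\<bar> * a - b) ^ 2 \<ge> 0" using k by simp
    ultimately have "(a / 2 + \<bar>s\<bar> * k * b) ^ 2 \<le> (1 / 2 + s ^ 2 * k) * (a ^ 2 / 2 + b ^ 2 * k)"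
      by linarith
    also have "1 / 2 + s ^ 2 * k = R ^ 2" by (simp add: R(2) k_def)
    also have "a ^ 2 / 2 + b ^ 2 * k \<le> wsq (snd p)"
      using wsq_two_le[OF z n] by (simp add: a_def b_def k_def)
    finally have "(a / 2 + \<bar>s\<bar> * k * b) ^ 2 \<le> R ^ 2 * wsq (snd p)"
      by (simp add: mult_left_mono)
    then have "a / 2 + \<bar>s\<bar> * k * b \<le> sqrt (R ^ 2 * wsq (snd p))" by (rule real_le_rsqrt)
    also have "\<dots> = R * sqrt (wsq (snd p))" using R(1) by (simp add: real_sqrt_mult)
    finally show "(a / 2 + \<bar>s\<bar> * k * b) / R \<le> sqrt (wsq (snd p))"
      using R(1) by (simp add: field_simps)
  qed
  finally show ?thesis by (simp add: Znorm_wsq)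
qed

text \<open>The functional does not see the first component, so one and the same functional supports
  the points for all \<open>t\<close> in the unit disc. This freedom in \<open>t\<close> drives the
  argument.\<close>

lemma curve_PiX:
  assumes "n \<noteq> 0" "norm t \<le> 1" "\<bar>s\<bar> \<le> 1"
  shows "(pt_curve n t s, fn_curve n s) \<in> PiX"
proof -
  have le: "norm (fn_curve n s p) \<le> normX p" if "p \<in> Xset" for p :: "'a pt"
  proof -
    obtain K where "snd p \<in> bounded_by K" by (rule Xset_bounded_by[OF \<open>p \<in> Xset\<close>])
    from fn_curve_le[OF assms(1) this] Znorm_le_normX show ?thesis by (rule order_trans)
  qed
  have dual: "dualX (fn_curve n s :: 'a pt \<Rightarrow> 'a)"
    unfolding dualX_def
  proof (intro conjI)
    show "\<exists>C. \<forall>p\<in>Xset. norm (fn_curve n s p :: 'a) \<le> C * normX p"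
      using le by (intro exI[of _ 1]) auto
  qed (auto simp: fn_curve_def addX_def smulX_def algebra_simps add_divide_distrib)
  have le1: "norm (fn_curve n s p) \<le> 1" if "p \<in> ballX" for p :: "'a pt"
    using that le[of p] by (auto simp: ballX_def)
  have "dnorm (fn_curve n s :: 'a pt \<Rightarrow> 'a) = 1"
  proof (rule antisym)
    show "dnorm (fn_curve n s :: 'a pt \<Rightarrow> 'a) \<le> 1"
      unfolding dnorm_def using zero_ballX by (intro cSUP_least le1) auto
    have "pt_curve n t s \<in> ballX" using pt_curve_normed[OF assms] by (simp add: ballX_def)
    then have "norm (fn_curve n s (pt_curve n t s)) \<le> dnorm (fn_curve n s :: 'a pt \<Rightarrow> 'a)"
      unfolding dnorm_def by (rule cSUP_upper) (use le1 in \<open>auto intro!: bdd_aboveI[of _ 1]\<close>)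
    then show "1 \<le> dnorm (fn_curve n s :: 'a pt \<Rightarrow> 'a)" by (simp add: fn_curve_pt_curve[OF assms(1)])
  qed
  with dual pt_curve_normed[OF assms] fn_curve_pt_curve[OF assms(1)] show ?thesis
    by (simp add: PiX_def)
qed

text \<open>The base state does not depend on \<open>n\<close>: in the property
  \<open>\<eta>\<close> is fixed for one state before \<open>n\<close> is chosen.\<close>

lemma pt_curve_0: "pt_curve n 0 0 = pt_curve 1 0 0"
  by (simp add: pt_curve_def two_seq_def wrad_0 fun_eq_iff)

lemma fn_curve_0: "fn_curve n 0 = fn_curve 1 0"
  by (simp add: fn_curve_def wrad_0 fun_eq_iff)

text \<open>Expresses the image of the curve under a linear operator through the images of four
  vectors independent of \<open>t\<close> and \<open>s\<close>.\<close>

lemma pt_curve_decompose: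
  "pt_curve n t s =
    addX (addX (two_seq n 1 0, \<lambda>_. 0) (smulX t (two_seq n 0 1, \<lambda>_. 0)))
      (addX (smulX (of_real (1 / (1 + wrad n s))) (\<lambda>_. 0, two_seq n 1 0))
        (smulX (of_real (1 / (1 + wrad n s) * s)) (\<lambda>_. 0, two_seq n 0 1)))"
  by (auto simp: pt_curve_def addX_def smulX_def two_seq_def)

section \<open>The first-order condition at the base state\<close>

lemma DERIV_wrad_0: "(wrad n has_real_derivative 0) (at 0)"
  unfolding wrad_def by (auto intro!: derivative_eq_intros)

text \<open>As \<open>R\<close> is stationary at 0, so are all coefficients built from it; only the
  explicit factors \<open>s\<close> contribute, which leaves \<open>x3\<close>, \<open>y1\<close>
  and \<open>y2\<close>.\<close>

lemma DERIV_curve: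
  fixes R :: "real \<Rightarrow> real"
  assumes R: "(R has_real_derivative 0) (at 0)" and pos: "R 0 > 0" and k: "k > 0"
  shows "((\<lambda>s. (1 + 1 / (2 * R s)) * (x1 + 1 / (1 + R s) * x2 + 1 / (1 + R s) * s * x3)
      + s / (k * R s) * (y1 + 1 / (1 + R s) * y2 + 1 / (1 + R s) * s * y3)) has_real_derivative
      (1 + 1 / (2 * R 0)) * (x3 / (1 + R 0)) + (y1 + y2 / (1 + R 0)) / (k * R 0)) (at 0)"
proof -
  have c: "((\<lambda>s. 1 / (1 + R s)) has_real_derivative 0) (at 0)"
    and f: "((\<lambda>s. 1 + 1 / (2 * R s)) has_real_derivative 0) (at 0)"
    and g: "((\<lambda>s. 1 / (k * R s)) has_real_derivative 0) (at 0)"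
    using pos k by (auto intro!: derivative_eq_intros R)
  have "((\<lambda>s. f s * (x1 + c s * x2 + c s * s * x3) + s * g s * (y1 + c s * y2 + c s * s * y3))
      has_real_derivative f 0 * (c 0 * x3) + g 0 * (y1 + c 0 * y2)) (at 0)"
    if "(f has_real_derivative 0) (at 0)" "(c has_real_derivative 0) (at 0)"
      "(g has_real_derivative 0) (at 0)" for f c g :: "real \<Rightarrow> real"
    by (auto intro!: derivative_eq_intros that)
  from this[OF f c g] show ?thesis by simp
qed

text \<open>\<open>F t s\<close> has modulus at most 1, and modulus 1 at the origin. Maximality in
  \<open>t\<close> at \<open>s = 0\<close> kills \<open>W 0\<close>, so the maximum is attained at
  \<open>s = 0\<close> for every \<open>t\<close> in the disc. The derivative in \<open>s\<close>
  there is affine in \<open>t\<close> and vanishes throughout the disc, which kills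
  \<open>W n\<close>.\<close>

lemma attaining_coordinate_zero:
  fixes S :: "'k::{real_normed_field, real_inner} pt \<Rightarrow> 'k pt"
  assumes S: "opX S" and nr: "numrad S \<le> 1" and n: "n \<noteq> 0"
    and att: "norm (fn_curve n 0 (S (pt_curve n 0 0))) = 1"
  shows "snd (S (two_seq n 0 1, \<lambda>_. 0)) n = 0"
proof -
  define A where "A = snd (S (two_seq n 1 0, \<lambda>_. 0))"
  define W where "W = snd (S (two_seq n 0 1, \<lambda>_. 0))"
  define B where "B = snd (S (\<lambda>_. 0, two_seq n 1 0))"
  define V where "V = snd (S (\<lambda>_. 0, two_seq n 0 1))"
  define c where "c s = 1 / (1 + wrad n s)" for s
  define F where "F t s = fn_curve n s (S (pt_curve n t s))" for t s
  have [simp]: "(two_seq n a b, \<lambda>_. 0) \<in> Xset" "(\<lambda>_. 0, two_seq n a b) \<in> Xset" for a b :: 'k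
    by (simp_all add: Xset_def two_seq_c0) (simp_all add: c0_def)
  have Spt: "snd (S (pt_curve n t s)) i = A i + t * W i + (of_real (c s) * B i + of_real (c s * s) * V i)" for t s i
    using S unfolding opX_def pt_curve_decompose
    by (simp add: addX_Xset smulX_Xset A_def W_def B_def V_def c_def)
       (simp add: addX_def smulX_def)
  have F: "F t s = of_real (1 + 1 / (2 * wrad n s)) * (A 0 + t * W 0 + (of_real (c s) * B 0 + of_real (c s * s) * V 0))
      + of_real (s / (2 ^ Suc n * wrad n s)) * (A n + t * W n + (of_real (c s) * B n + of_real (c s * s) * V n))" for t s
    unfolding F_def fn_curve_def Spt ..
  have F1: "norm (F t s) \<le> 1" if "norm t \<le> 1" "\<bar>s\<bar> \<le> 1" for t s
    unfolding F_def using PiX_le_numrad[OF S curve_PiX[OF n that]] nr by linarith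
  define \<alpha> where "\<alpha> = F 0 0"
  have \<alpha>: "norm \<alpha> = 1" using att by (simp add: \<alpha>_def F_def)
  \<comment> \<open>The scalar in question rotates \<open>u\<close> to a nonnegative multiple of
    \<open>\<alpha>\<close>. For \<open>u = 0\<close> division returns 0 and both claims
    persist.\<close>
  have rot: "norm (of_real (norm u) * \<alpha> / u) \<le> 1" "of_real (norm u) * \<alpha> / u * u = of_real (norm u) * \<alpha>" for u :: 'k
    using \<alpha> by (auto simp: norm_mult norm_divide)
  have Ft: "F t 0 = \<alpha> + of_real (1 + 1 / (2 * wrad n 0)) * (t * W 0)" for t
    by (simp only: \<alpha>_def F distrib_left div_0 of_real_0 mult_zero_left mult_zero_right
        add_0_left add_0_right add_ac)
  \<comment> \<open>at s = 0 the value is affine in t with modulus at most 1, and of modulus 1 at t = 0\<close>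
  have W0: "W 0 = 0"
  proof (rule ccontr)
    assume "W 0 \<noteq> 0"
    define d where "d = (1 + 1 / (2 * wrad n 0)) * norm (W 0)"
    have d: "d > 0" using \<open>W 0 \<noteq> 0\<close> wrad_pos[of n 0] by (simp add: d_def add_pos_pos)
    have "F (of_real (norm (W 0)) * \<alpha> / W 0) 0 = of_real (1 + d) * \<alpha>"
      unfolding Ft rot(2) d_def by (simp add: algebra_simps)
    then have "norm (F (of_real (norm (W 0)) * \<alpha> / W 0) 0) = 1 + d"
      using d \<alpha> by (simp add: norm_mult del: of_real_add)
    with F1[OF rot(1)[of "W 0"], of 0] d show False by simp
  qed
  \<comment> \<open>With \<open>W 0 = 0\<close> the value \<open>F t 0\<close> is
    \<open>\<alpha>\<close> for every \<open>t\<close>, so the real function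
    \<open>inner \<alpha> (F t s)\<close> of \<open>s\<close> reaches its upper bound 1 at
    \<open>s = 0\<close>.\<close>
  have crit: "(1 + 1 / (2 * wrad n 0)) * (inner \<alpha> (V 0) / (1 + wrad n 0))
      + (inner \<alpha> (A n + t * W n) + inner \<alpha> (B n) / (1 + wrad n 0)) / (2 ^ Suc n * wrad n 0) = 0"
    if t: "norm t \<le> 1" for t
  proof -
    define G where "G s = inner \<alpha> (F t s)" for s
    have G: "G = (\<lambda>s. (1 + 1 / (2 * wrad n s)) * (inner \<alpha> (A 0) + 1 / (1 + wrad n s) * inner \<alpha> (B 0) + 1 / (1 + wrad n s) * s * inner \<alpha> (V 0))
      + s / (2 ^ Suc n * wrad n s) * (inner \<alpha> (A n + t * W n) + 1 / (1 + wrad n s) * inner \<alpha> (B n) + 1 / (1 + wrad n s) * s * inner \<alpha> (V n)))"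
      unfolding G_def F W0 c_def scaleR_conv_of_real[symmetric]
      by (simp only: inner_add_right inner_scaleR_right mult_zero_right add_0_right add.assoc)
    have "G s \<le> G 0" if s: "\<bar>s\<bar> < 1" for s
    proof -
      have "G s \<le> norm \<alpha> * norm (F t s)" unfolding G_def by (rule norm_cauchy_schwarz)
      also have "\<dots> \<le> 1" using F1[OF t, of s] s \<alpha> by simp
      also have "1 = G 0" using \<alpha> by (simp add: G_def Ft W0 flip: power2_norm_eq_inner)
      finally show ?thesis .
    qed
    then have max: "\<forall>s. \<bar>0 - s\<bar> < 1 \<longrightarrow> G s \<le> G 0" by simp
    show ?thesis
      by (rule DERIV_local_max[OF _ zero_less_one max], unfold G,
          rule DERIV_curve[OF DERIV_wrad_0 wrad_pos]) simp
  qed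
  \<comment> \<open>The critical equations at \<open>t\<close> and at 0 differ only in the term with
    \<open>W n\<close>, whose coefficient is nonzero.\<close>
  have "inner \<alpha> (A n + t * W n) = inner \<alpha> (A n + 0 * W n)" if t: "norm t \<le> 1" for t
    using trans[OF crit[OF t] crit[of 0, symmetric]] wrad_pos[of n 0] by simp
  from this[OF rot(1)[of "W n"]]
  have "inner \<alpha> (of_real (norm (W n)) * \<alpha>) = 0" by (simp only: rot(2)) (simp add: inner_add_right)
  then have "norm (W n) = 0"
    using \<alpha> by (simp add: inner_scaleR_right flip: scaleR_conv_of_real power2_norm_eq_inner)
  then show ?thesis by (simp add: W_def)
qed

section \<open>The operators that refute the property\<close>

definition coord_op :: "nat \<Rightarrow> 'k pt \<Rightarrow> 'k::real_normed_field pt" where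
  "coord_op n p = (\<lambda>_. 0, two_seq n (fst p 0) (fst p n))"

text \<open>The constant is the norm of e_0 + e_n in Z. As \<open>n\<close> grows it tends to
  \<open>1 + sqrt (1 / 2)\<close>, the value of \<open>coord_op n\<close> at the base state, so the
  base state nearly attains the numerical radius.\<close>

lemma normX_coord_op:
  assumes p: "p \<in> Xset" and n: "n \<noteq> 0"
  shows "normX (coord_op n p) \<le> (1 + wrad n 1) * normX p"
proof -
  define M where "M = normX p"
  have M: "norm (fst p 0) \<le> M" "norm (fst p n) \<le> M" "0 \<le> M"
    using norm_fst_le_normX[OF p] normX_nonneg[OF p] by (auto simp: M_def)
  have "wsq (two_seq n (fst p 0) (fst p n)) \<le> M ^ 2 / 2 + M ^ 2 / 2 ^ Suc n"
    unfolding wsq_two_seq[OF n] using M by (intro add_mono divide_right_mono power_mono) auto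
  also have "\<dots> = (wrad n 1 * M) ^ 2"
    unfolding power_mult_distrib wrad_square by (simp add: distrib_right)
  finally have "sqrt (wsq (two_seq n (fst p 0) (fst p n))) \<le> wrad n 1 * M"
    using M(3) wrad_pos[of n 1] by (intro real_le_lsqrt) auto
  with supn_le[OF two_seq_bounded_by[OF M(1,2)], of n]
  have "Znorm (two_seq n (fst p 0) (fst p n)) \<le> (1 + wrad n 1) * M"
    by (simp add: Znorm_wsq distrib_right)
  moreover have "0 \<le> (1 + wrad n 1) * M" using M(3) wrad_pos[of n 1] by simp
  ultimately show ?thesis by (simp add: normX_def coord_op_def M_def supn_def)
qed

lemma opX_coord_op:
  assumes "n \<noteq> 0" shows "opX (coord_op n :: 'k::real_normed_field pt \<Rightarrow> 'k pt)"
  unfolding opX_def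
proof (intro conjI)
  show "coord_op n ` Xset \<subseteq> (Xset :: 'k pt set)"
    by (auto simp: coord_op_def Xset_def two_seq_c0) (simp add: c0_def)
  show "\<exists>C. \<forall>p\<in>Xset. normX (coord_op n p :: 'k pt) \<le> C * normX p"
    using normX_coord_op[OF _ assms] by blast
qed (auto simp: coord_op_def addX_def smulX_def two_seq_def)

text \<open>The numerical radius \<open>v\<close> of \<open>coord_op n\<close> lies between
  \<open>1 + sqrt (1 / 2)\<close> and \<open>1 + wrad n 1\<close>, so after division by
  \<open>v\<close> the value at the base state tends to 1. An attaining \<open>S\<close> sends (e_n,
  0) to a point whose second component vanishes at \<open>n\<close>, where \<open>T\<close> has
  \<open>1 / v\<close>.\<close>

lemma not_Lpp_nu_X: "\<not> Lpp_nu TYPE('k::{real_normed_field, real_inner})"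
proof
  assume L: "Lpp_nu TYPE('k)"
  have "(pt_curve 1 0 0, fn_curve 1 0 :: 'k pt \<Rightarrow> 'k) \<in> PiX" by (rule curve_PiX) auto
  \<comment> \<open>The choice 1/2 matches the bound \<open>v \<le> 2\<close> below, which keeps the
    separating coordinate \<open>1 / v\<close> at least 1/2.\<close>
  from L[unfolded Lpp_nu_def, THEN spec, of "1 / 2", THEN mp, OF half_gt_zero[OF zero_less_one], THEN bspec, OF this]
  obtain \<eta> where \<eta>: "\<eta> > 0"
    and L': "\<And>T :: 'k pt \<Rightarrow> 'k pt. opX T \<Longrightarrow> numrad T = 1 \<Longrightarrow> norm (fn_curve 1 0 (T (pt_curve 1 0 0))) > 1 - \<eta> \<Longrightarrow>
       \<exists>S. opX S \<and> numrad S = 1 \<and> norm (fn_curve 1 0 (S (pt_curve 1 0 0))) = 1 \<and> opnorm (opdiff S T) < 1 / 2"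
    unfolding case_prod_conv by metis
  have "(\<lambda>n. 1 / 2 + 1 / 2 ^ Suc n) \<longlonglongrightarrow> (1 / 2 + 0 :: real)"
    using LIMSEQ_Suc[OF LIMSEQ_inverse_realpow_zero[of 2]]
    by (intro tendsto_add tendsto_const) (simp add: inverse_eq_divide)
  then have "(\<lambda>n. wrad n 1) \<longlonglongrightarrow> sqrt (1 / 2)"
    unfolding wrad_def using tendsto_real_sqrt by fastforce
  then have "(\<lambda>n. (1 + sqrt (1 / 2)) / (1 + wrad n 1)) \<longlonglongrightarrow> (1 + sqrt (1 / 2)) / (1 + sqrt (1 / 2))"
    by (intro tendsto_intros) (auto simp: add_pos_pos less_imp_neq[symmetric])
  then have "(\<lambda>n. (1 + sqrt (1 / 2)) / (1 + wrad n 1)) \<longlonglongrightarrow> 1"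
    by (simp add: add_pos_pos less_imp_neq[symmetric])
  then have "\<forall>\<^sub>F n in sequentially. (1 + sqrt (1 / 2)) / (1 + wrad n 1) > 1 - \<eta>"
    by (rule order_tendstoD) (use \<eta> in simp)
  with eventually_gt_at_top[of 0]
  have "\<forall>\<^sub>F n in sequentially. n > 0 \<and> (1 + sqrt (1 / 2)) / (1 + wrad n 1) > 1 - \<eta>"
    by eventually_elim simp
  then obtain n where n: "n \<noteq> 0" and near: "(1 + sqrt (1 / 2)) / (1 + wrad n 1) > 1 - \<eta>"
    by (auto simp: eventually_sequentially)
  let ?T0 = "coord_op n :: 'k pt \<Rightarrow> 'k pt"
  have T0: "opX ?T0" by (rule opX_coord_op[OF n])
  define v where "v = numrad ?T0"
  have base: "(pt_curve n 0 0, fn_curve n 0 :: 'k pt \<Rightarrow> 'k) \<in> PiX" by (rule curve_PiX[OF n]) auto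
  have R: "wrad n 0 > 0" "wrad n 0 ^ 2 = 1 / 2" using wrad_pos wrad_square[of n 0] by auto
  \<comment> \<open>Since \<open>wrad n 0\<close> is its own half-reciprocal, the coefficient of
    \<open>fn_curve n 0\<close> at coordinate 0 is \<open>1 + sqrt (1 / 2)\<close>.\<close>
  have "1 / (2 * wrad n 0) = wrad n 0" using R by (simp add: field_simps power2_eq_square)
  then have val: "fn_curve n 0 (?T0 (pt_curve n 0 0)) = of_real (1 + sqrt (1 / 2))"
    by (simp add: fn_curve_def coord_op_def pt_curve_def two_seq_def wrad_0)
  have "norm (of_real (1 + sqrt (1 / 2)) :: 'k) \<le> v"
    using PiX_le_numrad[OF T0 base] unfolding val v_def .
  then have v_ge: "1 + sqrt (1 / 2) \<le> v" unfolding norm_of_real by (rule abs_le_D1)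
  then have v0: "v > 0" by (smt (verit) real_sqrt_ge_zero zero_le_divide_1_iff)
  have "norm (f (?T0 x)) \<le> 1 + wrad n 1" if xf: "(x, f) \<in> PiX" for x f
  proof -
    have x: "x \<in> Xset" "normX x = 1" using xf by (auto simp: PiX_def)
    show ?thesis
      using PiX_norm_le[OF xf opX_Xset[OF T0 x(1)]] normX_coord_op[OF x(1) n] x(2) by simp
  qed
  then have v_le: "v \<le> 1 + wrad n 1"
    unfolding v_def numrad_def using base by (intro cSUP_least) auto
  have "wrad n 1 \<le> 1" unfolding wrad_def by (simp add: field_simps)
  with v_le have v2: "v \<le> 2" by simp
  define T where "T = (\<lambda>p. smulX (of_real (1 / v)) (?T0 p))"
  have T: "opX T" unfolding T_def by (rule opX_smulX[OF T0])
  have "numrad T = 1 / v * numrad ?T0"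
    unfolding T_def using v0 base by (intro numrad_smulX[OF T0]) auto
  then have nT: "numrad T = 1" using v0 by (simp add: v_def)
  have "fn_curve n 0 (T (pt_curve n 0 0)) = of_real (1 / v) * fn_curve n 0 (?T0 (pt_curve n 0 0))"
    unfolding T_def fn_curve_def smulX_def by (simp add: algebra_simps)
  then have "norm (fn_curve n 0 (T (pt_curve n 0 0))) = \<bar>1 / v\<bar> * \<bar>1 + sqrt (1 / 2)\<bar>"
    unfolding val by (simp only: norm_mult norm_of_real)
  also have "\<dots> = (1 + sqrt (1 / 2)) / v"
    using v0 abs_of_nonneg[of "1 + sqrt (1 / 2)"] by (simp del: real_sqrt_divide)
  also have "\<dots> \<ge> (1 + sqrt (1 / 2)) / (1 + wrad n 1)"
    using v_le v0 by (intro divide_left_mono) (auto simp: wrad_pos add_pos_pos)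
  finally have "norm (fn_curve 1 0 (T (pt_curve 1 0 0))) > 1 - \<eta>"
    using near by (simp only: pt_curve_0[of n] fn_curve_0[of n])
  from L'[OF T nT this] obtain S where S: "opX S" "numrad S = 1"
    "norm (fn_curve n 0 (S (pt_curve n 0 0))) = 1" "opnorm (opdiff S T) < 1 / 2"
    unfolding pt_curve_0[of n] fn_curve_0[of n] by blast
  let ?e = "(two_seq n 0 1, \<lambda>_. 0) :: 'k pt"
  have "supn (two_seq n 0 1 :: nat \<Rightarrow> 'k) \<le> 1" by (rule supn_le[OF two_seq_bounded_by]) auto
  then have e: "?e \<in> ballX"
    using zero_ballX[where ?'a = 'k] by (simp add: ballX_def Xset_def two_seq_c0 normX_def)
  have "snd (S ?e) n = 0" by (rule attaining_coordinate_zero[OF S(1) _ n S(3)]) (simp add: S(2))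
  moreover have "snd (T ?e) n = of_real (1 / v)"
    using n by (simp add: T_def smulX_def coord_op_def two_seq_def)
  ultimately have "1 / v \<le> opnorm (opdiff S T)"
    using opnorm_opdiff_ge[OF S(1) T e, of n] v0 by (simp add: norm_divide)
  moreover have "1 / v \<ge> 1 / 2" using v2 v0 by (simp add: field_simps)
  ultimately show False using S(4) by linarith
qed

theorem theorem3p11:
  shows "(strongly_subdiff TYPE(real) \<and> \<not> Lpp_nu TYPE(real)) \<and>
         (strongly_subdiff TYPE(complex) \<and> \<not> Lpp_nu TYPE(complex))"
  by (intro conjI strongly_subdiff_X not_Lpp_nu_X)

end
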